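(* Suppose $\alpha$ and $\beta$ are integers satisfying $0<\alpha<4\beta$. Let $q=e^{\pi i\tau}$ with $\operatorname{Im}\tau>0$, and let $x,y$ be nonzero complex numbers. Then \begin{align*} &\left(\sum_{m,n\in\mathbf Z}(-1)^{n}q^{\alpha(m+1/2)^2+\alpha(m+1/2)n+\beta n^2}x^{m+1/2}y^{n}\right)^2+\left(\sum_{m,n\in\mathbf Z}q^{\alpha m^2+\alpha mn+\beta n^2}x^my^n\right)^2\\ &=\left(\sum_{m,n\in\mathbf Z}(-1)^{n}q^{\alpha m^2+\alpha mn+\beta n^2}x^my^n\right)^2+\left(\sum_{m,n\in\mathbf Z}q^{\alpha(m+1/2)^2+\alpha(m+1/2)n+\beta n^2}x^{m+1/2}y^{n}\right)^2. \end{align*}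
   Context: Real powers of $q$ are $q^r=e^{\pi i r\tau}$. A square root $x^{1/2}$ is fixed once and for all, and $x^{m+1/2}=x^m x^{1/2}$ for integers $m$. *)

theory Defs
  imports "HOL-Analysis.Analysis"
begin

(* The real power q^r of the nome q = exp (pi i tau). It is a function of tau rather than of q,
   since q alone does not determine the branch when r is not an integer. *)
definition nome_powr :: "complex \<Rightarrow> real \<Rightarrow> complex" where
  "nome_powr \<tau> r = exp (of_real pi * \<i> * of_real r * \<tau>)"

(* The half-integer power x^(m + 1/2) = x^m x^(1/2), where the parameter s is the chosen
   square root x^(1/2), i.e. s^2 = x. *)
definition half_powi :: "complex \<Rightarrow> complex \<Rightarrow> int \<Rightarrow> complex" where
  "half_powi s x m = x powi m * s"

end

(* With Q(m,n) = alpha m^2 + alpha m n + beta n^2, completing the square gives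
   Q(m,n) = alpha/4 (2m+n)^2 + (beta - alpha/4) n^2, so after the substitution N = 2m + n
   (resp. N = 2m + 1 + n) each summand becomes f(N) g(n) with theta-type sequences f and g, and the
   only constraint left is a parity condition on (N,n). With f0, f1, g0, g1 the sums of f and g over
   the even and the odd integers, the unsigned sums are f0 g0 + f1 g1 and f1 g0 + f0 g1, and the
   sign (-1)^n flips g1. The identity is then
   (f1 g0 - f0 g1)^2 + (f0 g0 + f1 g1)^2 = (f0 g0 - f1 g1)^2 + (f1 g0 + f0 g1)^2. *)

theory Submission
  imports Defs
begin

lemma nome_powr_add: "nome_powr \<tau> (a + b) = nome_powr \<tau> a * nome_powr \<tau> b"
  by (simp add: nome_powr_def algebra_simps flip: exp_add)

lemma norm_nome_powr: "norm (nome_powr \<tau> r) = exp (- (pi * Im \<tau> * r))"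
  by (simp add: nome_powr_def)

text \<open>The term is \<open>(k ^ n * r) ^ n\<close>, whose base tends to 0; once the base is
  below 1/2, a geometric series dominates, however large \<open>r\<close> is.\<close>

lemma summable_power_square:
  fixes k r :: real
  assumes "0 \<le> k" "k < 1" "0 \<le> r"
  shows "summable (\<lambda>n. k ^ (n\<^sup>2) * r ^ n)"
proof (rule summable_comparison_test_ev)
  have "(\<lambda>n. k ^ n * r) \<longlonglongrightarrow> 0 * r"
    using assms by (intro tendsto_intros LIMSEQ_power_zero) auto
  then have "eventually (\<lambda>n. k ^ n * r < 1/2) sequentially"
    by (rule order_tendstoD) auto
  then show "eventually (\<lambda>n. norm (k ^ (n\<^sup>2) * r ^ n) \<le> (1/2) ^ n) sequentially"
  proof eventually_elim
    case (elim n)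
    have "k ^ (n\<^sup>2) * r ^ n = (k ^ n * r) ^ n"
      by (simp add: power_mult_distrib power2_eq_square power_mult)
    then show ?case
      using elim assms by (simp add: power_mono del: power_mult_distrib)
  qed
  show "summable (\<lambda>n. (1/2 :: real) ^ n)"
    by (rule summable_geometric) simp
qed

lemma summable_on_intI:
  fixes f :: "int \<Rightarrow> real"
  assumes "(\<lambda>n::nat. f (int n)) summable_on UNIV" "(\<lambda>n::nat. f (- int n)) summable_on UNIV"
  shows "f summable_on UNIV"
proof -
  have "f summable_on range int"
    using assms(1) by (subst summable_on_reindex) (auto simp: o_def)
  moreover have "f summable_on range (\<lambda>n. - int n)"
    using assms(2) by (subst summable_on_reindex) (auto simp: o_def inj_on_def)
  moreover have "range int \<union> range (\<lambda>n. - int n) = UNIV"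
    by (auto intro: int_cases2)
  ultimately show ?thesis
    by (metis summable_on_union)
qed

text \<open>Absolute convergence of a general Jacobi theta series. Each half of the integers reduces
  to \<open>summable_power_square\<close>, with \<open>r\<close> equal to \<open>norm z\<close> for
  n \<ge> 0 and \<open>norm (inverse z)\<close> for n \<le> 0.\<close>

lemma theta_abs_summable:
  fixes c :: real and z :: complex
  assumes "c > 0" "Im \<tau> > 0"
  shows "(\<lambda>n::int. norm (nome_powr \<tau> (c * (of_int n)\<^sup>2) * z powi n)) summable_on UNIV"
proof (rule summable_on_intI)
  define k where "k = exp (- (pi * Im \<tau> * c))"
  have k: "0 \<le> k" "k < 1"
    using assms by (auto simp: k_def)
  have norm_nome: "norm (nome_powr \<tau> (c * (real n)\<^sup>2)) = k ^ (n\<^sup>2)" for n :: nat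
    by (simp add: norm_nome_powr k_def mult_ac flip: exp_of_nat_mult)
  have main: "(\<lambda>n. k ^ (n\<^sup>2) * r ^ n) summable_on UNIV" if "0 \<le> r" for r :: real
    using summable_power_square[OF k that] k(1) that
    by (intro norm_summable_imp_summable_on) simp
  show "(\<lambda>n. norm (nome_powr \<tau> (c * (of_int (int n))\<^sup>2) * z powi int n)) summable_on UNIV"
    using main[of "norm z"] by (simp add: norm_mult norm_power norm_nome)
  show "(\<lambda>n. norm (nome_powr \<tau> (c * (of_int (- int n))\<^sup>2) * z powi (- int n))) summable_on UNIV"
    using main[of "norm (inverse z)"]
    by (simp add: norm_mult norm_power norm_nome power_int_minus norm_inverse power_inverse)
qed

text \<open>Fubini: the iterated sums of norms converge, so the product family is absolutely
  summable and may be summed one coordinate at a time.\<close>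

lemma has_sum_mult_Times:
  fixes f :: "'a \<Rightarrow> complex" and g :: "'b \<Rightarrow> complex"
  assumes f: "(\<lambda>n. norm (f n)) summable_on A" and g: "(\<lambda>n. norm (g n)) summable_on B"
  shows "((\<lambda>(x, y). f x * g y) has_sum infsum f A * infsum g B) (A \<times> B)"
proof -
  have "(\<lambda>p. norm (case p of (x, y) \<Rightarrow> f x * g y)) summable_on A \<times> B"
    unfolding Infinite_Sum.abs_summable_on_Sigma_iff
    using f g by (auto simp: norm_mult infsum_cmult_right' infsum_nonneg
        intro!: summable_on_cmult_right summable_on_cmult_left)
  then have summable: "(\<lambda>(x, y). f x * g y) summable_on A \<times> B"
    by (rule Infinite_Sum.abs_summable_summable)
  then have "infsum (\<lambda>(x, y). f x * g y) (A \<times> B) = infsum f A * infsum g B"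
    by (simp flip: infsum_Sigma'_banach add: infsum_cmult_right' infsum_cmult_left')
  then show ?thesis
    using has_sum_infsum[OF summable] by simp
qed

text \<open>The map (m, n) \<mapsto> (2m + p + n, n) is a bijection from pairs of integers onto the
  pairs (k, n) with k - p and n of equal parity. These form two disjoint rectangles, and the double
  sum factors on each.\<close>

lemma infsum_parity_lattice:
  fixes f g :: "int \<Rightarrow> complex"
  assumes f: "(\<lambda>n. norm (f n)) summable_on UNIV" and g: "(\<lambda>n. norm (g n)) summable_on UNIV"
  shows "(\<Sum>\<^sub>\<infinity>(m, n)\<in>UNIV. f (2 * m + p + n) * g n) =
           infsum f {k. even (k - p)} * infsum g {n. even n}
         + infsum f {k. odd (k - p)} * infsum g {n. odd n}"
proof (rule infsumI)
  let ?E = "{k. even (k - p)} \<times> {n. even n}" and ?O = "{k. odd (k - p)} \<times> {n. odd n}"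
  let ?S = "infsum f {k. even (k - p)} * infsum g {n. even n}
         + infsum f {k. odd (k - p)} * infsum g {n. odd n}"
  have sub: "(\<lambda>n. norm (f n)) summable_on A" "(\<lambda>n. norm (g n)) summable_on A" for A
    using f g by (auto intro: summable_on_subset_banach)
  have "((\<lambda>(k, n). f k * g n) has_sum ?S) (?E \<union> ?O)"
    by (intro has_sum_Un_disjoint has_sum_mult_Times sub) auto
  also have "?this \<longleftrightarrow> ((\<lambda>(m, n). f (2 * m + p + n) * g n) has_sum ?S) UNIV"
    \<comment> \<open>On both rectangles k - p - n is even, so the \<open>div 2\<close> is
      exact.\<close>
    by (rule has_sum_reindex_bij_witness[where i = "\<lambda>(m, n). (2 * m + p + n, n)"
          and j = "\<lambda>(k, n). ((k - p - n) div 2, n)"]) auto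
  finally show "((\<lambda>(m, n). f (2 * m + p + n) * g n) has_sum ?S) UNIV" .
qed

theorem corollary5p2:
  fixes \<alpha> \<beta> :: int and \<tau> x y s :: complex
  assumes "0 < \<alpha>" and "\<alpha> < 4 * \<beta>"
    and "Im \<tau> > 0"
    and "x \<noteq> 0" and "y \<noteq> 0"
    and "s\<^sup>2 = x"
  shows
    "(\<Sum>\<^sub>\<infinity>(m::int, n::int)\<in>UNIV. (-1) powi n *
        nome_powr \<tau> (of_int \<alpha> * (of_int m + 1/2)\<^sup>2 + of_int \<alpha> * (of_int m + 1/2) * of_int n
                     + of_int \<beta> * (of_int n)\<^sup>2) * half_powi s x m * y powi n)\<^sup>2
     + (\<Sum>\<^sub>\<infinity>(m::int, n::int)\<in>UNIV.
        nome_powr \<tau> (of_int \<alpha> * (of_int m)\<^sup>2 + of_int \<alpha> * of_int m * of_int n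
                     + of_int \<beta> * (of_int n)\<^sup>2) * x powi m * y powi n)\<^sup>2
     = (\<Sum>\<^sub>\<infinity>(m::int, n::int)\<in>UNIV. (-1) powi n *
        nome_powr \<tau> (of_int \<alpha> * (of_int m)\<^sup>2 + of_int \<alpha> * of_int m * of_int n
                     + of_int \<beta> * (of_int n)\<^sup>2) * x powi m * y powi n)\<^sup>2
     + (\<Sum>\<^sub>\<infinity>(m::int, n::int)\<in>UNIV.
        nome_powr \<tau> (of_int \<alpha> * (of_int m + 1/2)\<^sup>2 + of_int \<alpha> * (of_int m + 1/2) * of_int n
                     + of_int \<beta> * (of_int n)\<^sup>2) * half_powi s x m * y powi n)\<^sup>2"
proof -
  \<comment> \<open>Powers of \<open>s\<close> treat both kinds of exponent alike, since x^(a/2) is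
    \<open>s powi a\<close>. The base \<open>y / s\<close> in \<open>g\<close> cancels the surplus
    \<open>s powi n\<close> in \<open>f (a + n)\<close>.\<close>
  define f where "f = (\<lambda>N::int. nome_powr \<tau> (of_int \<alpha> / 4 * (of_int N)\<^sup>2) * s powi N)"
  define g where "g = (\<lambda>n::int. nome_powr \<tau> ((of_int \<beta> - of_int \<alpha> / 4) * (of_int n)\<^sup>2) * (y / s) powi n)"
  define h where "h = (\<lambda>n::int. (-1) powi n * g n)"
  have s: "s \<noteq> 0"
    using assms by auto
  have f_summable: "(\<lambda>n. norm (f n)) summable_on UNIV"
    unfolding f_def using assms by (intro theta_abs_summable) auto
  \<comment> \<open>This makes the quadratic coefficient in \<open>g\<close> positive, so its theta
    series converges.\<close>
  have "of_int \<alpha> / 4 < (of_int \<beta> :: real)"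
    using assms(2) by linarith
  then have g_summable: "(\<lambda>n. norm (g n)) summable_on UNIV"
    unfolding g_def using assms by (intro theta_abs_summable) auto
  then have h_summable: "(\<lambda>n. norm (h n)) summable_on UNIV"
    by (simp add: h_def norm_mult norm_power_int)
  have h_even: "infsum h {n. even n} = infsum g {n. even n}"
    by (intro infsum_cong) (auto simp: h_def)
  have "infsum h {n. odd n} = infsum (\<lambda>n. - g n) {n. odd n}"
    by (intro infsum_cong) (auto simp: h_def)
  then have h_odd: "infsum h {n. odd n} = - infsum g {n. odd n}"
    by (simp add: infsum_uminus)

  \<comment> \<open>Here a/2 stands for the first summation variable: a = 2m gives the integral
    terms and a = 2m + 1 the half-integral ones.\<close>
  have factor: "nome_powr \<tau> (of_int \<alpha> * (of_int a / 2)\<^sup>2 + of_int \<alpha> * (of_int a / 2) * of_int n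
      + of_int \<beta> * (of_int n)\<^sup>2) * s powi a * y powi n = f (a + n) * g n" for a n :: int
  proof -
    have "of_int \<alpha> * (of_int a / 2)\<^sup>2 + of_int \<alpha> * (of_int a / 2) * of_int n + of_int \<beta> * (of_int n)\<^sup>2
        = of_int \<alpha> / 4 * (of_int (a + n))\<^sup>2 + (of_int \<beta> - of_int \<alpha> / 4) * (of_int n :: real)\<^sup>2"
      by (simp add: power2_eq_square field_simps)
    moreover have "s powi a * y powi n = s powi (a + n) * (y / s) powi n"
      using s by (simp add: power_int_add power_int_divide_distrib)
    ultimately show ?thesis
      by (simp add: f_def g_def nome_powr_add mult_ac)
  qed
  have x_powi: "x powi m = s powi (2 * m)" for m
    using assms(6) by (simp add: power_int_mult)
  have int_term: "nome_powr \<tau> (of_int \<alpha> * (of_int m)\<^sup>2 + of_int \<alpha> * of_int m * of_int n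
      + of_int \<beta> * (of_int n)\<^sup>2) * x powi m * y powi n = f (2 * m + 0 + n) * g n" for m n :: int
    using factor[of "2 * m" n] by (simp add: x_powi)
  have half_term: "nome_powr \<tau> (of_int \<alpha> * (of_int m + 1/2)\<^sup>2 + of_int \<alpha> * (of_int m + 1/2) * of_int n
      + of_int \<beta> * (of_int n)\<^sup>2) * half_powi s x m * y powi n = f (2 * m + 1 + n) * g n"
    for m n :: int
  proof -
    have "of_int (2 * m + 1) / 2 = (of_int m + 1/2 :: real)"
      by simp
    moreover have "s powi (2 * m + 1) = half_powi s x m"
      using s by (simp add: half_powi_def x_powi power_int_add)
    ultimately show ?thesis
      using factor[of "2 * m + 1" n] by (simp only:)
  qed
  have signed: "(-1) powi n * a * b * c = f k * h n" if "a * b * c = f k * g n" for a b c k n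
    using that by (simp add: h_def mult_ac)

  let ?f0 = "infsum f {k. even k}" and ?f1 = "infsum f {k. odd k}"
  let ?g0 = "infsum g {n. even n}" and ?g1 = "infsum g {n. odd n}"
  \<comment> \<open>For p = 1 the set of k with k - p even consists of the odd integers, so
    \<open>?f0\<close> and \<open>?f1\<close> trade places.\<close>
  note lattice = infsum_parity_lattice[OF f_summable g_summable]
    infsum_parity_lattice[OF f_summable h_summable]
  have "(\<Sum>\<^sub>\<infinity>(m, n)\<in>UNIV. f (2 * m + 0 + n) * g n) = ?f0 * ?g0 + ?f1 * ?g1"
    and "(\<Sum>\<^sub>\<infinity>(m, n)\<in>UNIV. f (2 * m + 0 + n) * h n) = ?f0 * ?g0 - ?f1 * ?g1"
    and "(\<Sum>\<^sub>\<infinity>(m, n)\<in>UNIV. f (2 * m + 1 + n) * g n) = ?f1 * ?g0 + ?f0 * ?g1"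
    and "(\<Sum>\<^sub>\<infinity>(m, n)\<in>UNIV. f (2 * m + 1 + n) * h n) = ?f1 * ?g0 - ?f0 * ?g1"
    using lattice[of 0] lattice[of 1] by (simp_all add: h_even h_odd)
  then show ?thesis
    unfolding signed[OF int_term] signed[OF half_term] int_term half_term
    \<comment> \<open>The cross terms cancel, and both sides equal (f0^2 + f1^2)(g0^2 + g1^2), as in
      the Brahmagupta-Fibonacci identity.\<close>
    by (simp only:) (simp add: power2_eq_square algebra_simps)
qed

end
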